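(* Let $0<\epsilon\le 1/e$, let $\gamma>1$, and let $m,n\in\mathbb{N}$ satisfy $n\ge\sqrt{\gamma^2-1}\,\log(1/\epsilon)$ and $$m\ \ge\ \frac{36\,n\log(1/\epsilon)}{\sqrt{\gamma^2-1}}.$$ Then $$C(m,n,\gamma,\epsilon):=\sup\Big\{\|p\|_{[-1,1],\infty}:\ p\in\mathbb{P}_n,\ \|p\|_{m,\infty}\le 1,\ \|p\|_{[-\gamma,\gamma],\infty}\le 1/\epsilon\Big\}\ \le\ c$$ for some numerical constant $c>0$ (independent of $m,n,\gamma,\epsilon$). Specifically, $c$ can be taken as $c=4\beta+3$, where $\beta$ is the Coppersmith–Rivlin constant.
   Context: $\mathbb{P}_n$ is the space of (complex) polynomials of degree at most $n$. For an interval $I$, $\|g\|_{I,\infty}=\sup_{x\in I}|g(x)|$. For $m\ge1$, $x_i=-1+2i/m$, $i=0,\dots,m$, are the equispaced nodes on $[-1,1]$, and $\|g\|_{m,\infty}=\max_{0\le i\le m}|g(x_i)|$. Coppersmith–Rivlin constant: let $B(m,n)=\sup\{\|p\|_{[-1,1],\infty}: p\in\mathbb{P}_n,\ \|p\|_{m,\infty}\le1\}$. By a known theorem of Coppersmith and Rivlin there exist constants $\beta\ge\alpha>1$ such that $\alpha^{n^2/m}\le B(m,n)\le\beta^{n^2/m}$ for all integers $1\le n\le m$. Fix such a $\beta$. *)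

theory Defs
  imports "HOL-Analysis.Analysis" "HOL-Computational_Algebra.Polynomial"
begin

text \<open>Suprema are taken in \<^typ>\<open>ereal\<close>, so that they are meaningful without any
  boundedness side condition.\<close>

definition sup_norm :: "real set \<Rightarrow> (real \<Rightarrow> complex) \<Rightarrow> ereal" where
  "sup_norm I g = (SUP x\<in>I. ereal (cmod (g x)))"

definition node :: "nat \<Rightarrow> nat \<Rightarrow> real" where
  "node m i = -1 + 2 * real i / real m"

text \<open>Only meaningful for \<open>m \<ge> 1\<close>: for \<open>m = 0\<close> the nodes degenerate because of division by zero.\<close>

definition grid_norm :: "nat \<Rightarrow> (real \<Rightarrow> complex) \<Rightarrow> real" where
  "grid_norm m g = (MAX i\<in>{0..m}. cmod (g (node m i)))"

definition poly_space :: "nat \<Rightarrow> complex poly set" where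
  "poly_space n = {p. degree p \<le> n}"

definition real_fun :: "complex poly \<Rightarrow> real \<Rightarrow> complex" where
  "real_fun p x = poly p (complex_of_real x)"

definition B :: "nat \<Rightarrow> nat \<Rightarrow> ereal" where
  "B m n = (SUP p \<in> {p \<in> poly_space n. grid_norm m (real_fun p) \<le> 1}.
              sup_norm {-1..1} (real_fun p))"

definition C :: "nat \<Rightarrow> nat \<Rightarrow> real \<Rightarrow> real \<Rightarrow> ereal" where
  "C m n \<gamma> \<epsilon> = (SUP p \<in> {p \<in> poly_space n. grid_norm m (real_fun p) \<le> 1 \<and>
                            sup_norm {-\<gamma>..\<gamma>} (real_fun p) \<le> ereal (1 / \<epsilon>)}.
                  sup_norm {-1..1} (real_fun p))"

text \<open>Coppersmith and Rivlin's theorem is often quoted two-sided, with an additional lower bound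
  \<open>\<alpha> powr (n\<^sup>2 / m) \<le> B m n\<close> for some \<open>1 < \<alpha> \<le> \<beta>\<close> and all \<open>1 \<le> n \<le> m\<close>. Read literally, that
  lower bound fails for \<open>n = 1\<close>: a linear polynomial attains its maximum modulus on the interval
  at an endpoint, which is a node, so \<open>B m 1 = 1 < \<alpha> powr (1 / m)\<close>. Requiring it would leave no
  \<open>\<beta>\<close> at all. The constant \<open>\<beta>\<close> is therefore characterised by the upper bound alone, which is
  implied by the two-sided estimate.\<close>

definition coppersmith_rivlin_constant :: "real \<Rightarrow> bool" where
  "coppersmith_rivlin_constant \<beta> \<longleftrightarrow>
     1 < \<beta> \<and>
     (\<forall>m n::nat. 1 \<le> n \<and> n \<le> m \<longrightarrow> B m n \<le> ereal (\<beta> powr ((real n)\<^sup>2 / real m)))"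

end

theory Submission
  imports Defs "HOL-Complex_Analysis.Complex_Analysis"
begin

text \<open>
  On \<open>[-1, 1]\<close> the polynomial is bounded by 7, which is below \<open>4 * \<beta> + 3\<close> for every \<open>\<beta> > 1\<close>.
  Write \<open>L = ln (1 / \<epsilon>)\<close>, \<open>s = sqrt (\<gamma>\<^sup>2 - 1)\<close>, \<open>r = s * L / n \<le> 1\<close>, and let \<open>\<bar>p\<bar>\<close> attain its maximum
  \<open>X > 1\<close> over \<open>[-1, 1]\<close> at \<open>x\<close>. By Bernstein--Walsh on \<open>[-\<gamma>, \<gamma>]\<close>, \<open>\<bar>p\<bar>\<close> is at most \<open>exp (25 * L / 8)\<close> on the
  ellipse of parameter 4 around a subinterval \<open>J\<close> of \<open>[-1, 1]\<close> of half-length \<open>r\<close> containing \<open>x\<close>. On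
  \<open>J\<close> we have \<open>\<bar>p\<bar> \<le> X\<close>, so the maximum principle, in the annulus that the Joukowski map folds onto the
  ellipse, shows that near \<open>J\<close> the polynomial \<open>p\<close> behaves as if its degree were \<open>K \<approx> 5 * L / 2\<close>. In
  particular \<open>\<bar>p\<bar> \<le> X * exp 2\<close> on a disc around \<open>x\<close> of radius about \<open>2 * r / K\<^sup>2\<close>, several times the
  distance from \<open>x\<close> to the nearest node. As \<open>x\<close> is a critical point of the real part of a rotation
  of \<open>p\<close>, Taylor expansion gives \<open>X - 1 \<le> \<theta> * X\<close> with \<open>\<theta> < 3 / 4\<close>.
\<close>

section \<open>The Joukowski map and confocal ellipses\<close>

definition joukowski :: "complex \<Rightarrow> complex" where
  "joukowski w = (w + inverse w) / 2"

text \<open>The two solutions \<open>z + d\<close> and \<open>z - d\<close> of the quadratic for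
  \<open>w\<close> have product 1, so one of them lies in the closed unit disc.\<close>

lemma joukowski_surj_cball:
  obtains w where "w \<noteq> 0" "cmod w \<le> 1" "joukowski w = z"
proof -
  define d where "d = csqrt (z\<^sup>2 - 1)"
  have d2: "d\<^sup>2 = z\<^sup>2 - 1" by (simp add: d_def)
  have prod: "(z + d) * (z - d) = 1"
    using d2 by (simp add: algebra_simps power2_eq_square)
  hence nz: "z + d \<noteq> 0" "z - d \<noteq> 0" by auto
  have inv: "inverse (z + d) = z - d" "inverse (z - d) = z + d"
    using prod by (auto intro!: inverse_unique simp: mult.commute)
  have "cmod (z + d) * cmod (z - d) = 1"
    using prod by (metis norm_mult norm_one)
  hence "cmod (z + d) \<le> 1 \<or> cmod (z - d) \<le> 1"
    by (smt (verit) mult_less_cancel_left2 norm_ge_zero)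
  thus thesis
    using that[of "z + d"] that[of "z - d"] nz inv by (auto simp: joukowski_def)
qed

lemma joukowski_polar:
  assumes "\<rho> > 0"
  shows "joukowski (of_real \<rho> * cis t) =
           Complex ((\<rho> + 1 / \<rho>) / 2 * cos t) ((\<rho> - 1 / \<rho>) / 2 * sin t)"
proof -
  have "inverse (of_real \<rho> * cis t) = of_real (1 / \<rho>) * cis (- t)"
    by (simp add: cis_inverse[symmetric] inverse_eq_divide)
  thus ?thesis by (simp add: joukowski_def complex_eq_iff field_simps)
qed

lemma joukowski_unit_circle:
  assumes "cmod w = 1"
  shows "joukowski w = of_real (Re w)"
proof -
  have "w * cnj w = 1" using assms by (simp add: complex_norm_square[symmetric])
  hence "inverse w = cnj w" by (rule inverse_unique)
  thus ?thesis by (simp add: joukowski_def complex_eq_iff)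
qed

text \<open>Both distances are moduli of squares, \<open>(w - 1)\<^sup>2 / (2 * w)\<close> and
  \<open>(w + 1)\<^sup>2 / (2 * w)\<close>, so the parallelogram law applies. Circles around 0 thus
  go to ellipses with foci -1 and 1.\<close>

lemma joukowski_focal_sum:
  assumes "w \<noteq> 0"
  shows "cmod (joukowski w - 1) + cmod (joukowski w + 1) = cmod w + 1 / cmod w"
proof -
  have "joukowski w - 1 = (w - 1)\<^sup>2 / (2 * w)" "joukowski w + 1 = (w + 1)\<^sup>2 / (2 * w)"
    using assms by (simp_all add: joukowski_def field_simps power2_eq_square)
  hence "cmod (joukowski w - 1) + cmod (joukowski w + 1) =
      ((cmod (w - 1))\<^sup>2 + (cmod (w + 1))\<^sup>2) / (2 * cmod w)"
    by (simp add: norm_divide norm_power norm_mult add_divide_distrib)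
  also have "(cmod (w - 1))\<^sup>2 + (cmod (w + 1))\<^sup>2 = 2 * (cmod w)\<^sup>2 + 2"
    unfolding cmod_power2 by (simp add: power2_eq_square algebra_simps)
  also have "(2 * (cmod w)\<^sup>2 + 2) / (2 * cmod w) = cmod w + 1 / cmod w"
    using assms by (simp add: field_simps power2_eq_square)
  finally show ?thesis .
qed

text \<open>Used to turn a bound on a focal sum into a bound on \<open>1 / cmod w\<close>.\<close>

lemma add_inverse_le_imp_le:
  fixes a b :: real
  assumes "1 \<le> a" "0 < b" "b + 1 / b \<le> a + 1 / a"
  shows "b \<le> a"
proof (rule ccontr)
  assume "\<not> b \<le> a"
  hence "b > a" by simp
  have "(b - a) * (a * b - 1) \<le> 0"
    using assms by (simp add: field_simps power2_eq_square)
  moreover have "a * b > 1 * 1" using assms \<open>b > a\<close> by (intro mult_le_less_imp_less) auto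
  ultimately show False using \<open>b > a\<close> by (simp add: mult_le_0_iff)
qed

section \<open>The Bernstein--Walsh inequality\<close>

text \<open>The factor \<open>v ^ n\<close> cancels the pole at 0, so the product \<open>F\<close>
  is a polynomial in \<open>v\<close>. The unit circle folds onto the real interval where
  \<open>bd\<close> applies, and the maximum principle carries the bound into the disc.\<close>

lemma bernstein_walsh:
  assumes deg: "degree p \<le> n" and \<gamma>: "\<gamma> \<ge> 0"
    and bd: "\<And>x. \<bar>x\<bar> \<le> \<gamma> \<Longrightarrow> cmod (poly p (of_real x)) \<le> G"
    and w: "w \<noteq> 0" "cmod w \<le> 1"
  shows "cmod (poly p (of_real \<gamma> * joukowski w)) * cmod w ^ n \<le> G"
proof -
  define F where "F v = (\<Sum>i\<le>n. coeff p i * (of_real \<gamma> / 2 * (v\<^sup>2 + 1)) ^ i * v ^ (n - i))"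
    for v :: complex
  have F: "F v = v ^ n * poly p (of_real \<gamma> * joukowski v)" if "v \<noteq> 0" for v
  proof -
    have "poly p (of_real \<gamma> * joukowski v) =
        (\<Sum>i\<le>n. coeff p i * (of_real \<gamma> * joukowski v) ^ i)"
      unfolding poly_altdef using deg
      by (intro sum.mono_neutral_left) (auto simp: coeff_eq_0 not_le)
    moreover have "v ^ n * (coeff p i * (of_real \<gamma> * joukowski v) ^ i) =
        coeff p i * (of_real \<gamma> / 2 * (v\<^sup>2 + 1)) ^ i * v ^ (n - i)" if "i \<le> n" for i
    proof -
      have e: "of_real \<gamma> / 2 * (v\<^sup>2 + 1) = v * (of_real \<gamma> * joukowski v)"
        using \<open>v \<noteq> 0\<close> by (simp add: joukowski_def field_simps power2_eq_square)
      have "v ^ n = v ^ i * v ^ (n - i)" using that by (simp flip: power_add)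
      thus ?thesis unfolding e power_mult_distrib by simp
    qed
    ultimately show ?thesis unfolding F_def
      by (simp only: sum_distrib_left) (intro sum.cong refl, simp only: atMost_iff)
  qed
  have "cmod (F w) \<le> G"
  proof (rule maximum_modulus_frontier[where f = F and S = "cball 0 1"])
    show "F holomorphic_on interior (cball 0 1)" unfolding F_def by (intro holomorphic_intros)
    show "continuous_on (closure (cball 0 1)) F" unfolding F_def by (intro continuous_intros)
    fix v assume "v \<in> frontier (cball (0::complex) 1)"
    hence v: "cmod v = 1" by (simp add: dist_norm)
    hence "v \<noteq> 0" by auto
    have "\<bar>\<gamma> * Re v\<bar> \<le> \<gamma>"
      using abs_Re_le_cmod[of v] \<gamma> v by (simp add: abs_mult mult_left_le)
    thus "cmod (F v) \<le> G"
      using bd[of "\<gamma> * Re v"] v by (simp add: F[OF \<open>v \<noteq> 0\<close>] joukowski_unit_circle norm_mult norm_power)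
  qed (use w in auto)
  thus ?thesis using w by (simp add: F norm_mult norm_power mult.commute)
qed

text \<open>The ellipse has semi-axes \<open>a = sqrt (1 + \<sigma>\<^sup>2)\<close> and \<sigma>,
  hence foci -1 and 1. On it the distance to the focus \<open>e\<close> equals
  \<open>a - e * Re z / a\<close>, inside it is at most that, and the two foci add up to
  \<open>2 * a\<close>.\<close>

lemma focal_sum_le_of_ellipse:
  assumes \<sigma>: "\<sigma> > 0"
    and xy: "(Re z)\<^sup>2 / (1 + \<sigma>\<^sup>2) + (Im z)\<^sup>2 / \<sigma>\<^sup>2 \<le> 1"
  shows "cmod (z - 1) + cmod (z + 1) \<le> 2 * sqrt (1 + \<sigma>\<^sup>2)"
proof -
  define a where "a = sqrt (1 + \<sigma>\<^sup>2)"
  have a2: "a\<^sup>2 = 1 + \<sigma>\<^sup>2" by (simp add: a_def)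
  have a1: "a \<ge> 1" by (simp add: a_def)
  have y: "(Im z)\<^sup>2 \<le> \<sigma>\<^sup>2 - \<sigma>\<^sup>2 * (Re z)\<^sup>2 / a\<^sup>2"
    using xy \<sigma> by (simp add: a2[symmetric] field_simps)
  have "(Re z)\<^sup>2 / a\<^sup>2 \<le> 1" using xy \<sigma>
    by (smt (verit, best) a2 divide_nonneg_nonneg zero_le_power2)
  hence "(Re z)\<^sup>2 \<le> a\<^sup>2" using a1 by (simp add: divide_le_eq)
  hence x: "\<bar>Re z\<bar> \<le> a" using a1 by (simp add: abs_le_square_iff[symmetric])
  have xa: "\<bar>Re z / a\<bar> \<le> a"
    using x a1 by (simp add: divide_le_eq abs_mult) (smt (verit) mult_le_cancel_left1)
  have sq: "(a - e * Re z / a)\<^sup>2 = (Re z - e)\<^sup>2 + (\<sigma>\<^sup>2 - \<sigma>\<^sup>2 * (Re z)\<^sup>2 / a\<^sup>2)"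
    if "e\<^sup>2 = 1" for e :: real
  proof -
    have "(a - e * Re z / a)\<^sup>2 = a\<^sup>2 - 2 * e * Re z + e\<^sup>2 * (Re z)\<^sup>2 / a\<^sup>2"
      using a1 by (simp add: power2_eq_square field_simps)
    moreover have "\<sigma>\<^sup>2 * (Re z)\<^sup>2 / a\<^sup>2 = (Re z)\<^sup>2 - (Re z)\<^sup>2 / a\<^sup>2"
    proof -
      have e: "\<sigma>\<^sup>2 = a\<^sup>2 - 1" using a2 by simp
      show ?thesis using a1 unfolding e by (simp add: algebra_simps diff_divide_distrib)
    qed
    ultimately show ?thesis using that a2 by (simp add: power2_diff)
  qed
  have "cmod (z - of_real e) \<le> a - e * Re z / a" if "e\<^sup>2 = 1" for e :: real
  proof (rule power2_le_imp_le)
    show "(cmod (z - of_real e))\<^sup>2 \<le> (a - e * Re z / a)\<^sup>2"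
      using y sq[OF that] by (simp add: cmod_power2)
    show "0 \<le> a - e * Re z / a" using xa that unfolding power2_eq_1_iff abs_le_iff by auto
  qed
  from this[of 1] this[of "-1"] show ?thesis by (simp add: a_def)
qed

text \<open>The left side is twice the cosh of arsinh \<open>x\<close>, and arsinh \<open>x\<close>
  is at most \<open>x\<close>.\<close>

lemma sqrt_add_square_le_exp:
  fixes x :: real assumes "x \<ge> 0"
  shows "2 * sqrt (1 + x\<^sup>2) \<le> exp x + 1 / exp x"
proof -
  have "x \<le> sinh x"
    using real_le_x_sinh[OF assms] by (simp add: sinh_def exp_minus)
  hence "1 + x\<^sup>2 \<le> (cosh x)\<^sup>2"
    using assms power_mono[of x "sinh x" 2] by (simp add: cosh_square_eq)
  hence "sqrt (1 + x\<^sup>2) \<le> cosh x" by (simp add: real_le_lsqrt)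
  thus ?thesis by (simp add: cosh_def exp_minus inverse_eq_divide)
qed

text \<open>After scaling by \<gamma>, the focal sum bounds \<open>1 / cmod w\<close> by
  \<open>exp \<sigma>\<close>, so each of the \<open>n\<close> degrees costs at most a factor
  \<open>exp \<sigma>\<close>.\<close>

lemma bernstein_walsh_ellipse:
  assumes deg: "degree p \<le> n" and \<gamma>: "\<gamma> > 0"
    and bd: "\<And>x. \<bar>x\<bar> \<le> \<gamma> \<Longrightarrow> cmod (poly p (of_real x)) \<le> G"
    and \<sigma>: "\<sigma> > 0"
    and xy: "(Re z)\<^sup>2 / (1 + \<sigma>\<^sup>2) + (Im z)\<^sup>2 / \<sigma>\<^sup>2 \<le> \<gamma>\<^sup>2"
  shows "cmod (poly p z) \<le> G * exp (n * \<sigma>)"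
proof -
  obtain w where w: "w \<noteq> 0" "cmod w \<le> 1" "joukowski w = z / of_real \<gamma>"
    using joukowski_surj_cball by blast
  have "(Re (z / of_real \<gamma>))\<^sup>2 / (1 + \<sigma>\<^sup>2) + (Im (z / of_real \<gamma>))\<^sup>2 / \<sigma>\<^sup>2
      = ((Re z)\<^sup>2 / (1 + \<sigma>\<^sup>2) + (Im z)\<^sup>2 / \<sigma>\<^sup>2) / \<gamma>\<^sup>2"
    by (simp add: power_divide add_divide_distrib mult.commute)
  also have "\<dots> \<le> 1" using xy \<gamma> by (simp add: divide_le_eq)
  finally have "cmod w + 1 / cmod w \<le> 2 * sqrt (1 + \<sigma>\<^sup>2)"
    using focal_sum_le_of_ellipse[OF \<sigma>, of "z / of_real \<gamma>"] joukowski_focal_sum[OF w(1)] w(3) by simp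
  also have "\<dots> \<le> exp \<sigma> + 1 / exp \<sigma>" using sqrt_add_square_le_exp \<sigma> by simp
  finally have "1 / cmod w + 1 / (1 / cmod w) \<le> exp \<sigma> + 1 / exp \<sigma>" by simp
  hence "1 / cmod w \<le> exp \<sigma>"
    using w(1) \<sigma> by (intro add_inverse_le_imp_le[of "exp \<sigma>" "1 / cmod w"]) (simp, simp)
  hence "1 \<le> exp \<sigma> * cmod w" using w by (simp add: field_simps)
  hence "1 \<le> (exp \<sigma> * cmod w) ^ n" by (simp add: one_le_power)
  hence one: "1 \<le> exp (n * \<sigma>) * cmod w ^ n"
    by (simp add: power_mult_distrib exp_of_nat_mult)
  have "cmod (poly p z) \<le> cmod (poly p z) * (exp (n * \<sigma>) * cmod w ^ n)"
    using one by (simp add: mult_left_le mult_le_cancel_left1)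
  also have "\<dots> = (cmod (poly p z) * cmod w ^ n) * exp (n * \<sigma>)" by (simp add: mult_ac)
  also have "\<dots> \<le> G * exp (n * \<sigma>)"
    using bernstein_walsh[OF deg less_imp_le[OF \<gamma>] bd w(1,2)] w(3) \<gamma>
    by (intro mult_right_mono) auto
  finally show ?thesis .
qed

section \<open>Localisation to a subinterval\<close>

text \<open>The maximum principle for \<open>F\<close> on an annulus that avoids the pole at 0. The
  weight may then have any exponent \<open>K\<close> compatible with the bound on the inner circle,
  and \<open>K\<close> takes over the role of the degree.\<close>

lemma bound_on_joukowski_annulus:
  fixes c r :: real and p :: "complex poly"
  assumes a: "0 < a" "a \<le> 1"
    and outer: "\<And>x. \<bar>x - c\<bar> \<le> r \<Longrightarrow> cmod (poly p (of_real x)) \<le> X" and r: "r \<ge> 0"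
    and inner: "\<And>v. cmod v = a \<Longrightarrow> cmod (poly p (of_real c + of_real r * joukowski v)) * a ^ K \<le> X"
    and w: "a \<le> cmod w" "cmod w \<le> 1"
  shows "cmod (poly p (of_real c + of_real r * joukowski w)) * cmod w ^ K \<le> X"
proof -
  define F where "F v = v ^ K * poly p (of_real c + of_real r * joukowski v)" for v
  let ?S = "cball 0 1 - ball (0::complex) a"
  have S: "v \<noteq> 0" if "v \<in> ?S" for v using that a by auto
  have "closed ?S" by (intro closed_Diff) auto
  have "cmod (F w) \<le> X"
  proof (rule maximum_modulus_frontier[where f = F and S = ?S])
    show "F holomorphic_on interior ?S"
    proof (rule holomorphic_on_subset[OF _ interior_subset])
      have "(poly p \<circ> (\<lambda>v. of_real c + of_real r * joukowski v)) holomorphic_on ?S"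
        unfolding joukowski_def using S
        by (intro holomorphic_on_compose holomorphic_intros) auto
      thus "F holomorphic_on ?S" unfolding F_def o_def
        by (rule holomorphic_on_mult[OF holomorphic_on_power[OF holomorphic_on_ident]])
    qed
    show "continuous_on (closure ?S) F"
      unfolding F_def joukowski_def closure_closed[OF \<open>closed ?S\<close>] using S
      by (intro continuous_intros) auto
    fix v assume v: "v \<in> frontier ?S"
    \<comment> \<open>The open annulus is interior, so frontier points lie on one of the two
      circles.\<close>
    have "ball 0 1 - cball 0 a \<subseteq> interior ?S"
      by (rule interior_maximal) (auto intro: open_Diff)
    hence "v \<notin> ball 0 1 - cball 0 a" "v \<in> ?S"
      using v \<open>closed ?S\<close> by (auto simp: frontier_def)
    hence "cmod v = 1 \<or> cmod v = a" by (auto simp: dist_norm)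
    thus "cmod (F v) \<le> X"
    proof
      assume 1: "cmod v = 1"
      have "\<bar>(c + r * Re v) - c\<bar> \<le> r"
        using abs_Re_le_cmod[of v] r 1 by (simp add: abs_mult mult_left_le)
      from outer[OF this] show ?thesis
        using 1 by (simp add: F_def joukowski_unit_circle norm_mult norm_power)
    next
      assume "cmod v = a"
      thus ?thesis using inner[of v] by (simp add: F_def norm_mult norm_power mult.commute)
    qed
  qed (use w in \<open>auto intro: bounded_subset[OF bounded_cball]\<close>)
  thus ?thesis by (simp add: F_def norm_mult norm_power mult.commute)
qed

text \<open>The constants \<open>17 / 8\<close> and \<open>15 / 8\<close> are \<open>cosh (ln 4)\<close> and \<open>sinh (ln 4)\<close>, the semi-axes of the
  image of the circle of radius \<open>1 / 4\<close>.\<close>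

lemma ellipse_subset_ellipse:
  fixes c r s \<sigma> :: real
  assumes r: "0 \<le> r" "\<bar>c\<bar> \<le> 1 - r" and s: "s > 0" and \<sigma>: "\<sigma> > 0" "\<sigma> * s = 17 / 8 * r"
    and v: "cmod v = 1 / 4" and z: "z = of_real c + of_real r * joukowski v"
  shows "(Re z)\<^sup>2 / (1 + \<sigma>\<^sup>2) + (Im z)\<^sup>2 / \<sigma>\<^sup>2 \<le> 1 + s\<^sup>2"
proof -
  define t where "t = Arg v"
  have v': "v = of_real (1 / 4) * cis t"
    using rcis_cmod_Arg[of v] v by (simp add: rcis_def t_def)
  have "joukowski v = Complex (17 / 8 * cos t) (- (15 / 8) * sin t)"
    unfolding v' by (subst joukowski_polar) (auto simp: field_simps)
  hence re: "Re z = c + r * (17 / 8 * cos t)" and im: "Im z = - r * (15 / 8 * sin t)"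
    by (simp_all add: z)
  have "\<bar>Re z\<bar> \<le> \<bar>c\<bar> + \<bar>r * (17 / 8 * cos t)\<bar>" unfolding re by (rule abs_triangle_ineq)
  also have "\<dots> \<le> 1 + \<sigma> * s * \<bar>cos t\<bar>" using r by (simp add: \<sigma>(2) abs_mult)
  finally have "(Re z)\<^sup>2 \<le> (1 + \<sigma> * s * \<bar>cos t\<bar>)\<^sup>2" by (metis abs_ge_zero power2_abs power_mono)
  \<comment> \<open>Cauchy--Schwarz for the vectors \<open>(1, \<sigma>)\<close> and
    \<open>(1, s * \<bar>cos t\<bar>)\<close>, via Lagrange's identity.\<close>
  also have "\<dots> \<le> (1 + \<sigma> * s * \<bar>cos t\<bar>)\<^sup>2 + (\<sigma> - s * \<bar>cos t\<bar>)\<^sup>2" by simp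
  also have "\<dots> = (1 + \<sigma>\<^sup>2) * (1 + s\<^sup>2 * (cos t)\<^sup>2)"
    by (simp add: power2_eq_square algebra_simps)
  finally have x: "(Re z)\<^sup>2 / (1 + \<sigma>\<^sup>2) \<le> 1 + s\<^sup>2 * (cos t)\<^sup>2"
    by (simp add: divide_le_eq mult.commute add_pos_nonneg)
  have "(Im z)\<^sup>2 = (15 / 8 * r)\<^sup>2 * (sin t)\<^sup>2"
    unfolding im power_mult_distrib[symmetric] by (simp add: mult_ac)
  \<comment> \<open>Enlarging the minor semi-axis to the major one lets the same relation between
    \<sigma> and \<open>s\<close> serve both coordinates.\<close>
  also have "\<dots> \<le> (17 / 8 * r)\<^sup>2 * (sin t)\<^sup>2" using r by (intro mult_right_mono power_mono) auto
  also have "\<dots> = \<sigma>\<^sup>2 * (s\<^sup>2 * (sin t)\<^sup>2)" by (simp only: \<sigma>(2)[symmetric] power_mult_distrib mult.assoc)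
  finally have y: "(Im z)\<^sup>2 / \<sigma>\<^sup>2 \<le> s\<^sup>2 * (sin t)\<^sup>2" using \<sigma> by (simp add: divide_le_eq mult.commute)
  have "s\<^sup>2 * (cos t)\<^sup>2 + s\<^sup>2 * (sin t)\<^sup>2 = s\<^sup>2"
    by (simp flip: distrib_left)
  with x y show ?thesis by linarith
qed

text \<open>After rescaling to [-1, 1], the centre \<open>y\<close> has focal sum 2. Moving by at
  most \<open>E\<close> changes each focal distance by at most \<open>E\<close>, so the focal sum
  stays below \<open>2 + 2 * E = \<rho> + 1 / \<rho>\<close>.\<close>

lemma disc_in_joukowski_annulus:
  fixes c r x :: real
  assumes r: "r > 0" "\<bar>x - c\<bar> \<le> r" and \<rho>: "\<rho> \<ge> 1"
    and z: "cmod (z - of_real x) \<le> r * ((\<rho> + 1 / \<rho>) / 2 - 1)"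
  obtains w where "w \<noteq> 0" "cmod w \<le> 1" "1 / cmod w \<le> \<rho>" "z = of_real c + of_real r * joukowski w"
proof -
  define Z where "Z = (z - of_real c) / of_real r"
  define y where "y = (x - c) / r"
  obtain w where w: "w \<noteq> 0" "cmod w \<le> 1" "joukowski w = Z"
    using joukowski_surj_cball by blast
  have y: "\<bar>y\<bar> \<le> 1" using r by (simp add: y_def)
  have Zy: "Z - of_real y = (z - of_real x) / of_real r" 
    by (simp add: Z_def y_def diff_divide_distrib)
  define E where "E = (\<rho> + 1 / \<rho>) / 2 - 1"
  from Zy have "cmod (Z - of_real y) \<le> E" unfolding E_def
    using z r by (simp add: norm_divide divide_le_eq mult.commute)
  moreover have "cmod (Z - 1) \<le> cmod (Z - of_real y) + cmod (of_real (y - 1))"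
    "cmod (Z + 1) \<le> cmod (Z - of_real y) + cmod (of_real (y + 1))"
    using norm_triangle_ineq[of "Z - of_real y" "of_real (y - 1)"]
      norm_triangle_ineq[of "Z - of_real y" "of_real (y + 1)"] by (simp_all add: algebra_simps)
  moreover have "\<bar>y - 1\<bar> + \<bar>y + 1\<bar> = 2" using y by simp
  moreover have "cmod (Z - 1) + cmod (Z + 1) = cmod w + 1 / cmod w"
    using joukowski_focal_sum[OF w(1)] by (simp add: w(3))
  ultimately have "cmod w + 1 / cmod w \<le> 2 * E + 2"
    unfolding norm_of_real by linarith
  hence "1 / cmod w + 1 / (1 / cmod w) \<le> \<rho> + 1 / \<rho>" by (simp add: E_def)
  hence "1 / cmod w \<le> \<rho>"
    using w(1) \<rho> by (intro add_inverse_le_imp_le[of \<rho> "1 / cmod w"]) simp_all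
  thus thesis using that[of w] w r by (simp add: Z_def)
qed

section \<open>Taylor expansion at a maximum point\<close>

text \<open>Cauchy's inequalities bound the \<open>k\<close>-th Taylor term by
  \<open>M * q ^ k\<close>; the remainder is the geometric tail from \<open>k = 2\<close>
  on.\<close>

lemma taylor2_remainder_bound:
  assumes hol: "f holomorphic_on ball x R" and cont: "continuous_on (cball x R) f"
    and bd: "\<And>z. cmod (z - x) \<le> R \<Longrightarrow> cmod (f z) \<le> M"
    and y: "cmod (y - x) \<le> q * R" and q: "0 \<le> q" "q < 1" and R: "R > 0"
  shows "cmod (f y - f x - deriv f x * (y - x)) \<le> M * q\<^sup>2 / (1 - q)"
proof -
  let ?t = "\<lambda>k. (deriv ^^ k) f x / fact k * (y - x) ^ k"
  have M: "M \<ge> 0" using bd[of x] R by (smt (verit) diff_self norm_ge_zero norm_zero)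
  have "q * R < R" using q R by simp
  hence "y \<in> ball x R" using y by (simp add: dist_norm norm_minus_commute)
  hence s: "?t sums f y" by (rule holomorphic_power_series[OF hol])
  have s2: "(\<lambda>k. ?t (k + 2)) sums (f y - f x - deriv f x * (y - x))"
    using sums_split_initial_segment[OF s, of 2] by (simp add: numeral_2_eq_2 algebra_simps)
  have le: "cmod (?t k) \<le> M * q ^ k" for k
  proof -
    have "cmod ((deriv ^^ k) f x) \<le> fact k * M / R ^ k"
      by (rule Cauchy_inequality[OF hol cont R]) (auto intro!: bd simp: dist_norm norm_minus_commute)
    hence "cmod ((deriv ^^ k) f x) / fact k \<le> M / R ^ k" by (simp add: field_simps)
    hence "cmod (?t k) \<le> M / R ^ k * (q * R) ^ k"
      unfolding norm_mult norm_divide norm_power norm_fact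
      using y M R by (intro mult_mono power_mono) auto
    thus ?thesis using R by (simp add: power_mult_distrib)
  qed
  have g: "(\<lambda>k. M * q ^ (k + 2)) sums (M * q\<^sup>2 / (1 - q))"
    using sums_mult[OF geometric_sums[of q], of "M * q\<^sup>2"] q by (simp add: power_add power2_eq_square mult_ac)
  show ?thesis
    using norm_suminf_le[OF le sums_summable[OF g]] sums_unique[OF s2] sums_unique[OF g] by metis
qed

lemma nearest_node:
  assumes m: "m > 0" and x: "\<bar>x\<bar> \<le> 1"
  obtains i where "i \<le> m" "\<bar>node m i - x\<bar> \<le> 1 / m"
proof -
  define t where "t = (x + 1) * m / 2"
  have t: "0 \<le> t" "t \<le> real m" using x m by (auto simp: t_def abs_le_iff divide_le_eq)
  define i where "i = nat (round t)"
  have "round t \<ge> 0" using round_mono[OF t(1)] by simp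
  hence i: "real i = of_int (round t)" by (simp add: i_def)
  have "round t \<le> int m" using round_mono[OF t(2)] by simp
  hence "i \<le> m" by (simp add: i_def)
  moreover have "\<bar>real i - t\<bar> \<le> 1 / 2" unfolding i by (rule of_int_round_abs_le)
  moreover have "node m i - x = 2 * (real i - t) / m"
    using m by (simp add: node_def t_def field_simps)
  hence "\<bar>node m i - x\<bar> = 2 * \<bar>real i - t\<bar> / m" by (simp only: abs_mult abs_divide abs_of_nat abs_numeral)
  ultimately show thesis using that[of i] m by (simp add: divide_right_mono)
qed

text \<open>Multiplying by the conjugate of the value at \<open>x\<close> makes that value real and
  nonnegative. The real part \<open>?h\<close> is dominated by the modulus, with equality at
  \<open>x\<close>, so it has a local maximum there.\<close>

lemma critical_point_of_max_norm:
  fixes x d :: real and p :: "complex poly"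
  assumes "d > 0"
    and "\<And>t. \<bar>x - t\<bar> < d \<Longrightarrow> cmod (poly p (of_real t)) \<le> cmod (poly p (of_real x))"
  shows "Re (cnj (poly p (of_real x)) * poly (pderiv p) (of_real x)) = 0"
proof -
  let ?P = "poly p (of_real x)"
  let ?h = "\<lambda>t. Re (cnj ?P * poly p (of_real t))"
  have "((\<lambda>z. cnj ?P * poly p z) has_field_derivative cnj ?P * poly (pderiv p) (of_real x))
      (at (of_real x))"
    by (intro DERIV_cmult poly_DERIV)
  from bounded_linear.has_vector_derivative[OF bounded_linear_Re
      has_vector_derivative_real_field[OF this]]
  have "(?h has_real_derivative Re (cnj ?P * poly (pderiv p) (of_real x))) (at x)"
    by (simp add: has_real_derivative_iff_has_vector_derivative)
  moreover have "?h t \<le> ?h x" if "\<bar>x - t\<bar> < d" for t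
  proof -
    have "?h t \<le> cmod ?P * cmod (poly p (of_real t))"
      using complex_Re_le_cmod[of "cnj ?P * poly p (of_real t)"] by (simp only: norm_mult complex_mod_cnj)
    also have "\<dots> \<le> cmod ?P * cmod ?P" using assms(2)[OF that] by (intro mult_left_mono) auto
    also have "\<dots> = ?h x"
      unfolding power2_eq_square[symmetric] cmod_power2 by (simp add: power2_eq_square)
    finally show ?thesis .
  qed
  ultimately show ?thesis using DERIV_local_max[OF _ assms(1)] by blast
qed

text \<open>Taking real parts against \<open>cnj P\<close> removes the first-order term, so the drop
  from \<open>cmod P\<close> to at most 1 is paid for by the remainder alone.\<close>

lemma max_norm_le_of_taylor:
  fixes P Q D :: complex and h :: real
  assumes crit: "Re (cnj P * D) = 0"
    and rem: "cmod (Q - P - D * of_real h) \<le> \<theta> * cmod P" and Q: "cmod Q \<le> 1"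
  shows "cmod P * (1 - \<theta>) \<le> 1"
proof (cases "P = 0")
  case False
  have "Re (cnj P * (P - Q)) = - Re (cnj P * (Q - P - D * of_real h)) - h * Re (cnj P * D)"
    by (simp add: algebra_simps)
  also have "\<dots> \<le> cmod P * cmod (Q - P - D * of_real h)"
    using abs_Re_le_cmod[of "cnj P * (Q - P - D * of_real h)"] crit
    by (simp add: norm_mult)
  also have "\<dots> \<le> cmod P * (\<theta> * cmod P)" using rem by (intro mult_left_mono) auto
  finally have "Re (cnj P * (P - Q)) \<le> cmod P * (\<theta> * cmod P)" .
  moreover have "Re (cnj P * (P - Q)) = cmod P * cmod P - Re (cnj P * Q)"
    unfolding power2_eq_square[symmetric] cmod_power2 by (simp add: power2_eq_square algebra_simps)
  moreover have "Re (cnj P * Q) \<le> cmod P * cmod Q"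
    using complex_Re_le_cmod[of "cnj P * Q"] by (simp only: norm_mult complex_mod_cnj)
  moreover have "cmod P * cmod Q \<le> cmod P * 1" using Q by (intro mult_left_mono) auto
  ultimately have "cmod P * (cmod P * (1 - \<theta>)) \<le> cmod P * 1" by (simp add: algebra_simps)
  thus ?thesis using False by (subst (asm) mult_le_cancel_left_pos) auto
qed simp

section \<open>Quantitative bounds near the maximum\<close>

text \<open>Since 25/8 is 5/4 times 5/2, it suffices that \<open>exp (5 / 4) \<le> 4\<close>. This
  fixes how large \<open>K\<close> must be for the weight on the circle of radius 1/4 to absorb the
  Bernstein--Walsh bound.\<close>

lemma exp_le_four_power:
  assumes "5 / 2 * L \<le> real K"
  shows "exp (25 / 8 * L) \<le> 4 ^ K"
proof -
  have "exp (5 / 4 :: real) ^ 4 = exp 1 ^ 5" by (simp flip: exp_of_nat_mult)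
  also have "\<dots> \<le> (272 / 100) ^ 5" using e_less_272 by (intro power_mono) auto
  also have "\<dots> \<le> 4 ^ 4" by (simp add: field_simps)
  finally have "exp (5 / 4 :: real) \<le> 4" by (rule power_le_imp_le_base[of _ 3, simplified]) simp
  hence "exp (5 / 4 :: real) ^ K \<le> 4 ^ K" by (intro power_mono) auto
  moreover have "exp (25 / 8 * L) \<le> exp (5 / 4 * real K)" using assms by simp
  moreover have "exp (5 / 4 * real K) = exp (5 / 4) ^ K" by (simp flip: exp_of_nat_mult add: mult.commute)
  ultimately show ?thesis by linarith
qed

lemma bound_on_disc:
  fixes p :: "complex poly" and x L s \<gamma> :: real
  assumes deg: "degree p \<le> n"
    and s: "s > 0" and \<gamma>: "\<gamma> > 0" "\<gamma>\<^sup>2 = 1 + s\<^sup>2" and L: "L \<ge> 1"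
    and n: "s * L \<le> n" and K: "5 / 2 * L \<le> real K"
    and outer: "\<And>x. \<bar>x\<bar> \<le> \<gamma> \<Longrightarrow> cmod (poly p (of_real x)) \<le> exp L"
    and X: "\<And>x. \<bar>x\<bar> \<le> 1 \<Longrightarrow> cmod (poly p (of_real x)) \<le> X" "X \<ge> 1"
    and x: "\<bar>x\<bar> \<le> 1"
    and z: "cmod (z - of_real x) \<le> 2 * (s * L / n) / (real K * (real K + 2))"
  shows "cmod (poly p z) \<le> X * exp 2"
proof -
  have "s * L > 0" using s L by simp
  hence n0: "real n > 0" using n by linarith
  define r where "r = s * L / n"
  have r: "0 < r" "r \<le> 1" using \<open>s * L > 0\<close> n n0 by (auto simp: r_def)
  \<comment> \<open>Clamping \<open>x\<close> keeps the interval of half-length \<open>r\<close>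
    around \<open>c\<close> inside [-1, 1], while it still contains \<open>x\<close>.\<close>
  define c where "c = max (- (1 - r)) (min x (1 - r))"
  have c: "\<bar>c\<bar> \<le> 1 - r" "\<bar>x - c\<bar> \<le> r" using x r by (auto simp: c_def)
  \<comment> \<open>Besides meeting the ellipse inclusion, this gives
    \<open>n * \<sigma> = 17 / 8 * L\<close>; with the factor \<open>exp L\<close> the total
    exponent is \<open>25 / 8 * L\<close>.\<close>
  define \<sigma> where "\<sigma> = 17 / 8 * L / n"
  have \<sigma>: "\<sigma> > 0" "\<sigma> * s = 17 / 8 * r" using L n0 by (auto simp: \<sigma>_def r_def)
  have K0: "real K > 2" using K L by linarith
  \<comment> \<open>With this choice \<open>\<rho> ^ K\<close> is at most \<open>exp 2\<close>, and
    \<open>(\<rho> + 1 / \<rho>) / 2 - 1\<close> produces exactly the radius assumed for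
    \<open>z\<close>.\<close>
  define \<rho> where "\<rho> = 1 + 2 / real K"
  have \<rho>: "1 \<le> \<rho>" "\<rho> \<le> 4" using K0 by (auto simp: \<rho>_def divide_le_eq)
  have inner: "cmod (poly p (of_real c + of_real r * joukowski v)) * (1 / 4) ^ K \<le> X"
    if v: "cmod v = 1 / 4" for v
  proof -
    let ?z = "of_real c + of_real r * joukowski v"
    have "cmod (poly p ?z) \<le> exp L * exp (n * \<sigma>)"
      using bernstein_walsh_ellipse[OF deg \<gamma>(1) outer \<sigma>(1)] \<gamma>(2)
        ellipse_subset_ellipse[OF _ c(1) s \<sigma> v refl] r by simp
    also have "\<dots> = exp (25 / 8 * L)" using n0 by (simp add: \<sigma>_def flip: exp_add)
    also have "\<dots> \<le> 4 ^ K" using exp_le_four_power[OF K] .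
    finally have "cmod (poly p ?z) * (1 / 4) ^ K \<le> 1" by (simp add: power_divide)
    thus ?thesis using X(2) by linarith
  qed
  have "(\<rho> + 1 / \<rho>) / 2 - 1 = 2 / (real K * (real K + 2))"
  proof -
    have k: "real K \<noteq> 0" "real K + 2 \<noteq> 0" using K0 by auto
    hence "1 / \<rho> = real K / (real K + 2)" by (simp add: \<rho>_def add_divide_eq_iff)
    hence "(\<rho> + 1 / \<rho>) / 2 - 1 = (1 + 2 / real K + real K / (real K + 2)) / 2 - 1"
      by (simp add: \<rho>_def)
    also have "\<dots> = 2 / (real K * (real K + 2))"
      using k by (simp add: divide_simps) (simp add: algebra_simps)
    finally show ?thesis .
  qed
  hence "cmod (z - of_real x) \<le> r * ((\<rho> + 1 / \<rho>) / 2 - 1)"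
    using z by (simp add: r_def mult_ac)
  then obtain w where w: "w \<noteq> 0" "cmod w \<le> 1" "1 / cmod w \<le> \<rho>"
      "z = of_real c + of_real r * joukowski w"
    by (rule disc_in_joukowski_annulus[OF r(1) c(2) \<rho>(1)])
  have w4: "1 / 4 \<le> cmod w" using w(1) order.trans[OF w(3) \<rho>(2)] by (simp add: field_simps)
  have "cmod (poly p z) * cmod w ^ K \<le> X" unfolding w(4)
  proof (rule bound_on_joukowski_annulus[where a = "1 / 4"])
    fix y assume "\<bar>y - c\<bar> \<le> r"
    thus "cmod (poly p (of_real y)) \<le> X" using c(1) by (intro X(1)) linarith
  qed (use r w w4 inner in auto)
  hence "cmod (poly p z) \<le> X * (1 / cmod w) ^ K" using w(1) by (simp add: field_simps)
  also have "(1 / cmod w) ^ K \<le> \<rho> ^ K" using w(3) by (intro power_mono) auto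
  also have "\<rho> ^ K \<le> exp (2 / real K) ^ K"
    using exp_ge_add_one_self[of "2 / real K"] \<rho>(1) by (intro power_mono) (auto simp: \<rho>_def)
  also have "exp (2 / real K) ^ K = exp 2" using K0 by (simp flip: exp_of_nat_mult)
  finally show ?thesis using X(2) by (simp add: mult_left_mono)
qed

text \<open>The disc radius is of order \<open>s / (n * L)\<close>, and so is the bound that
  \<open>m\<close> imposes on the grid spacing; the constant 36 puts a node well inside the
  disc.\<close>

lemma grid_bound_imp_bound:
  fixes p :: "complex poly" and x L s \<gamma> :: real
  assumes deg: "degree p \<le> n"
    and s: "s > 0" and \<gamma>: "\<gamma> > 0" "\<gamma>\<^sup>2 = 1 + s\<^sup>2" and L: "L \<ge> 1"
    and n: "s * L \<le> n" and m: "36 * n * L / s \<le> m"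
    and outer: "\<And>x. \<bar>x\<bar> \<le> \<gamma> \<Longrightarrow> cmod (poly p (of_real x)) \<le> exp L"
    and grid: "\<And>i. i \<le> m \<Longrightarrow> cmod (poly p (of_real (node m i))) \<le> 1"
    and x: "\<bar>x\<bar> \<le> 1"
  shows "cmod (poly p (of_real x)) \<le> 7"
proof -
  have "s * L > 0" using s L by simp
  hence n0: "real n > 0" using n by linarith
  hence "36 * n * L / s > 0" using s L by simp
  hence m0: "m > 0" using m by linarith
  have "continuous_on {-1..1::real} (\<lambda>t. cmod (poly p (of_real t)))" by (intro continuous_intros)
  from continuous_attains_sup[OF _ _ this] obtain x0 where x0: "\<bar>x0\<bar> \<le> 1"
    and max: "\<And>t. \<bar>t\<bar> \<le> 1 \<Longrightarrow> cmod (poly p (of_real t)) \<le> cmod (poly p (of_real x0))"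
    by (auto simp: abs_le_iff)
  define X where "X = cmod (poly p (of_real x0))"
  have "X \<le> 7"
  proof (cases "X \<le> 1")
    case False
    hence X: "X > 1" by simp
    \<comment> \<open>The endpoints are nodes, so a maximum above 1 is interior and the derivative
      test applies.\<close>
    have "x0 \<noteq> -1" "x0 \<noteq> 1"
      using grid[of 0] grid[of m] X m0 by (auto simp: X_def node_def)
    hence d: "1 - \<bar>x0\<bar> > 0" using x0 by auto
    define K where "K = nat \<lceil>5 / 2 * L\<rceil>"
    have "real K = of_int \<lceil>5 / 2 * L\<rceil>" using L by (simp add: K_def)
    hence K: "5 / 2 * L \<le> real K" "real K \<le> 7 / 2 * L" using L by linarith+
    define R where "R = 2 * (s * L / n) / (real K * (real K + 2))"
    have K0: "real K > 0" using K L by linarith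
    have R: "R > 0" unfolding R_def using K0 n0 s L by (intro divide_pos_pos mult_pos_pos) auto
    have disc: "cmod (poly p z) \<le> X * exp 2" if "cmod (z - of_real x0) \<le> R" for z
      using that max X x0 unfolding R_def X_def
      by (intro bound_on_disc[OF deg s \<gamma> L n K(1) outer _ _ x0]) auto
    have "1 / m \<le> 27 / 100 * R"
    proof -
      \<comment> \<open>Here \<open>2 \<le> 2 * L\<close>. The product of 7/2 and 11/2 is 19.25,
        just below 36 times 27/50, which is 19.44.\<close>
      have "real K * (real K + 2) \<le> (7 / 2 * L) * (11 / 2 * L)"
        using K L K0 by (intro mult_mono) auto
      also have "\<dots> \<le> 27 / 50 * (36 * L\<^sup>2)" by (simp add: power2_eq_square)
      also have "36 * L\<^sup>2 = 36 * n * L / s * (s * L / n)"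
        using n0 s by (simp add: power2_eq_square)
      also have "\<dots> \<le> m * (s * L / n)" using m n0 s L by (intro mult_right_mono) auto
      finally have "real K * (real K + 2) \<le> 27 / 50 * (m * (s * L / n))" by simp
      moreover have "real K * (real K + 2) > 0" using K0 by simp
      ultimately have "1 \<le> 27 / 50 * (m * (s * L / n)) / (real K * (real K + 2))"
        by (subst le_divide_eq_1_pos)
      hence "1 / m \<le> 27 / 50 * (m * (s * L / n)) / (real K * (real K + 2)) / m"
        by (intro divide_right_mono) auto
      thus ?thesis using m0 by (simp add: R_def mult_ac)
    qed
    moreover obtain i where i: "i \<le> m" "\<bar>node m i - x0\<bar> \<le> 1 / m"
      using nearest_node[OF m0 x0] .
    ultimately have y: "cmod (of_real (node m i) - of_real x0) \<le> 27 / 100 * R"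
      by (simp flip: of_real_diff)
    have "(exp 1 :: real)\<^sup>2 \<le> (272 / 100)\<^sup>2" using e_less_272 by (intro power_mono) auto
    hence e2: "exp 2 \<le> (74 / 10 :: real)" by (simp add: power2_eq_square flip: exp_add)
    have "cmod (poly p (of_real (node m i)) - poly p (of_real x0)
        - deriv (poly p) (of_real x0) * (of_real (node m i) - of_real x0))
        \<le> X * exp 2 * (27 / 100)\<^sup>2 / (1 - 27 / 100)"
      by (rule taylor2_remainder_bound[OF _ _ disc y])
        (auto intro!: holomorphic_intros continuous_intros R)
    \<comment> \<open>Numerically, 7.4 * 0.0729 / 0.73 is about 0.739.\<close>
    also have "\<dots> \<le> 74 / 100 * X" using e2 X by (simp add: field_simps)
    finally have "cmod (poly p (of_real (node m i)) - poly p (of_real x0)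
        - poly (pderiv p) (of_real x0) * of_real (node m i - x0)) \<le> 74 / 100 * X"
      by (simp add: DERIV_imp_deriv[OF poly_DERIV])
    moreover have "Re (cnj (poly p (of_real x0)) * poly (pderiv p) (of_real x0)) = 0"
      by (rule critical_point_of_max_norm[OF d]) (auto intro!: max)
    ultimately have "X * (1 - 74 / 100) \<le> 1"
      unfolding X_def by (intro max_norm_le_of_taylor[OF _ _ grid[OF i(1)]])
    thus ?thesis by simp
  qed simp
  thus ?thesis using max[OF x] by (simp add: X_def)
qed

section \<open>From pointwise bounds to the suprema\<close>

lemma C_le_7:
  assumes \<epsilon>: "0 < \<epsilon>" "\<epsilon> \<le> 1 / exp 1" and \<gamma>: "1 < \<gamma>"
    and n: "real n \<ge> sqrt (\<gamma>\<^sup>2 - 1) * ln (1 / \<epsilon>)"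
    and m: "real m \<ge> 36 * real n * ln (1 / \<epsilon>) / sqrt (\<gamma>\<^sup>2 - 1)"
  shows "C m n \<gamma> \<epsilon> \<le> ereal 7"
  unfolding C_def
proof (rule SUP_least)
  fix p assume p: "p \<in> {p \<in> poly_space n. grid_norm m (real_fun p) \<le> 1 \<and>
      sup_norm {-\<gamma>..\<gamma>} (real_fun p) \<le> ereal (1 / \<epsilon>)}"
  have \<gamma>2: "\<gamma>\<^sup>2 > 1" using \<gamma> by (simp add: one_less_power)
  have "exp 1 \<le> 1 / \<epsilon>" using \<epsilon> by (simp add: field_simps)
  \<comment> \<open>The restriction of \<epsilon> to at most \<open>1 / exp 1\<close> provides
    \<open>L \<ge> 1\<close>, used above to absorb additive constants into multiples of
    \<open>L\<close>.\<close>
  hence L: "ln (1 / \<epsilon>) \<ge> 1" using \<epsilon>(1) by (simp add: ln_ge_iff del: ln_div ln_inverse)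
  have exp_L: "exp (ln (1 / \<epsilon>)) = 1 / \<epsilon>" using \<epsilon>(1) by (intro exp_ln) simp
  have outer: "cmod (poly p (of_real x)) \<le> exp (ln (1 / \<epsilon>))" if "\<bar>x\<bar> \<le> \<gamma>" for x
  proof -
    have "ereal (cmod (real_fun p x)) \<le> sup_norm {-\<gamma>..\<gamma>} (real_fun p)"
      unfolding sup_norm_def using that by (intro SUP_upper) auto
    also have "\<dots> \<le> ereal (1 / \<epsilon>)" using p by simp
    finally show ?thesis by (simp only: exp_L real_fun_def ereal_less_eq)
  qed
  have grid: "cmod (poly p (of_real (node m i))) \<le> 1" if "i \<le> m" for i
  proof -
    have "cmod (real_fun p (node m i)) \<le> grid_norm m (real_fun p)"
      unfolding grid_norm_def using that by (intro Max_ge) auto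
    thus ?thesis using p by (simp add: real_fun_def)
  qed
  show "sup_norm {-1..1} (real_fun p) \<le> ereal 7"
    unfolding sup_norm_def
  proof (rule SUP_least)
    fix x :: real assume "x \<in> {-1..1}"
    hence "\<bar>x\<bar> \<le> 1" by auto
    have "cmod (poly p (of_real x)) \<le> 7"
      by (rule grid_bound_imp_bound[OF _ _ _ _ L n m outer grid \<open>\<bar>x\<bar> \<le> 1\<close>])
        (use p \<gamma> \<gamma>2 in \<open>auto simp: poly_space_def\<close>)
    thus "ereal (cmod (real_fun p x)) \<le> ereal 7" by (simp add: real_fun_def)
  qed
qed

theorem theorem2p4:
  "(\<exists>c::real. 0 < c \<and>
      (\<forall>(\<epsilon>::real) (\<gamma>::real) (m::nat) (n::nat).
         0 < \<epsilon> \<and> \<epsilon> \<le> 1 / exp 1 \<and> 1 < \<gamma> \<and>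
         real n \<ge> sqrt (\<gamma>\<^sup>2 - 1) * ln (1 / \<epsilon>) \<and>
         real m \<ge> 36 * real n * ln (1 / \<epsilon>) / sqrt (\<gamma>\<^sup>2 - 1)
         \<longrightarrow> C m n \<gamma> \<epsilon> \<le> ereal c)) \<and>
   (\<forall>\<beta>::real. coppersmith_rivlin_constant \<beta> \<longrightarrow>
      0 < 4 * \<beta> + 3 \<and>
      (\<forall>(\<epsilon>::real) (\<gamma>::real) (m::nat) (n::nat).
         0 < \<epsilon> \<and> \<epsilon> \<le> 1 / exp 1 \<and> 1 < \<gamma> \<and>
         real n \<ge> sqrt (\<gamma>\<^sup>2 - 1) * ln (1 / \<epsilon>) \<and>
         real m \<ge> 36 * real n * ln (1 / \<epsilon>) / sqrt (\<gamma>\<^sup>2 - 1)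
         \<longrightarrow> C m n \<gamma> \<epsilon> \<le> ereal (4 * \<beta> + 3)))"
proof (intro conjI allI impI exI[of _ 7])
  fix \<beta> :: real assume "coppersmith_rivlin_constant \<beta>"
  hence \<beta>: "1 < \<beta>" by (simp add: coppersmith_rivlin_constant_def)
  thus "0 < 4 * \<beta> + 3" by simp
  fix \<epsilon> \<gamma> :: real and m n :: nat
  assume "0 < \<epsilon> \<and> \<epsilon> \<le> 1 / exp 1 \<and> 1 < \<gamma> \<and> sqrt (\<gamma>\<^sup>2 - 1) * ln (1 / \<epsilon>) \<le> real n \<and>
    36 * real n * ln (1 / \<epsilon>) / sqrt (\<gamma>\<^sup>2 - 1) \<le> real m"
  hence "C m n \<gamma> \<epsilon> \<le> ereal 7" using C_le_7 by blast
  \<comment> \<open>7 is the value of \<open>4 * \<beta> + 3\<close> at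
    \<open>\<beta> = 1\<close>.\<close>
  also have "\<dots> \<le> ereal (4 * \<beta> + 3)" using \<beta> by simp
  finally show "C m n \<gamma> \<epsilon> \<le> ereal (4 * \<beta> + 3)" .
qed (use C_le_7 in auto)

end
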